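(* Let $(\mathcal{U},F)$ be a unifiable second-order ground unification (SOGU) problem whose only function variable is $F$, where $F$ has arity $n$, let $h_1,\ldots,h_n\geq 0$ be non-negative integers, and let $\sigma=\{F\mapsto\lambda x_1\ldots x_n.s\}$ be a unifier of $(\mathcal{U},F)$ such that the individual variables of $s$ are among $x_1,\ldots,x_n$ and $\mathit{occ}_\Sigma(x_i,s)=h_i$ for all $1\leq i\leq n$. Then for all $g\in\Sigma$, $$\mathit{occ}_\Sigma(g,s)\cdot\bigl(\mathrm{mul}[F,\overline{h_n},\mathcal{U}]_l-\mathrm{mul}[F,\overline{h_n},\mathcal{U}]_r\bigr)=\mathrm{cnt}[F,\overline{h_n},g,\mathcal{U}]_r-\mathrm{cnt}[F,\overline{h_n},g,\mathcal{U}]_l.$$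
   Context: $\Sigma$ is a signature of function symbols with fixed arities (arity $0$ symbols are constants). Terms are built from $\Sigma$, individual variables, and function variables; a function variable of arity $n$ is applied to $n$ argument terms. A second-order ground term is a term with no individual variables and containing at least one function variable, all its function variables having the same arity. $\overline{h_n}$ abbreviates $h_1,\ldots,h_n$. $\mathit{occ}_\Sigma(c,t)$ is the number of occurrences of the symbol or variable $c$ in the term $t$. An SOGU problem $(\mathcal{U},F)$ consists of a function variable $F$ of arity $n>0$ and a finite set $\mathcal{U}$ of equations $u\stackrel{?}{=}_F v$ between second-order ground terms in each of which $F$ is the only function variable. A unifier is a substitution $\sigma=\{F\mapsto\lambda x_1\ldots x_n.s\}$, with $s$ containing no function variables, such that $u\sigma=v\sigma$ (syntactically) for every $u\stackrel{?}{=}_F v$ in $\mathcal{U}$; the problem is unifiable if it has a unifier. $t\sigma$ is taken in $\beta$-normal form: $F(t_1,\ldots,t_n)\sigma$ is the result of simultaneously replacing each $x_i$ in $s$ by $t_i\sigma$, and $f(t_1,\ldots,t_l)\sigma=f(t_1\sigma,\ldots,t_l\sigma)$ for $f\in\Sigma$. The following are defined recursively on terms $t$ with no individual variables and no function variable other than $F$. $n$-multiplier $\mathrm{mul}[F,\overline{h_n},t]$: it is $0$ if $t$ is a constant; $\mathrm{mul}[F,\overline{h_n},f(t_1,\ldots,t_l)]=\sum_{j=1}^l\mathrm{mul}[F,\overline{h_n},t_j]$ for $f\in\Sigma$; $\mathrm{mul}[F,\overline{h_n},F(t_1,\ldots,t_n)]=1+\sum_{i=1}^n h_i\cdot\mathrm{mul}[F,\overline{h_n},t_i]$.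 $n$-counter $\mathrm{cnt}[F,\overline{h_n},g,t]$ for $g\in\Sigma$: for $f\in\Sigma$ of arity $l\geq 0$, $\mathrm{cnt}[F,\overline{h_n},g,f(t_1,\ldots,t_l)]=\delta+\sum_{j=1}^l\mathrm{cnt}[F,\overline{h_n},g,t_j]$, where $\delta=1$ if $f=g$ and $\delta=0$ otherwise; $\mathrm{cnt}[F,\overline{h_n},g,F(t_1,\ldots,t_n)]=\sum_{i=1}^n h_i\cdot\mathrm{cnt}[F,\overline{h_n},g,t_i]$. For a problem $(\mathcal{U},F)$: $\mathrm{mul}[F,\overline{h_n},\mathcal{U}]_l$ and $\mathrm{mul}[F,\overline{h_n},\mathcal{U}]_r$ are the sums over all $u\stackrel{?}{=}_F v$ in $\mathcal{U}$ of $\mathrm{mul}[F,\overline{h_n},u]$ and of $\mathrm{mul}[F,\overline{h_n},v]$, respectively; $\mathrm{cnt}[F,\overline{h_n},g,\mathcal{U}]_l$ and $\mathrm{cnt}[F,\overline{h_n},g,\mathcal{U}]_r$ are the sums over all $u\stackrel{?}{=}_F v$ in $\mathcal{U}$ of $\mathrm{cnt}[F,\overline{h_n},g,u]$ and of $\mathrm{cnt}[F,\overline{h_n},g,v]$, respectively. *)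

theory Defs
  imports Main
begin

text \<open>The type \<open>'f\<close> is the signature, with arities given by a function \<open>ar\<close>; \<open>'v\<close> and \<open>'x\<close> are
  the individual and the function variables, the latter with arities given by \<open>arv\<close>. Arities are
  not built into the datatype but imposed by \<open>wf_trm\<close>.\<close>

datatype ('f, ivars: 'v, fvars: 'x) trm =
    Var 'v
  | Fun 'f "('f, 'v, 'x) trm list"
  | FVar 'x "('f, 'v, 'x) trm list"

lemma size_nth_less [termination_simp]:
  "i < length ts \<Longrightarrow> size (ts ! i) < Suc (size_list size ts)"
  by (rule le_imp_less_Suc, rule size_list_estimation'[OF nth_mem order_refl])

fun wf_trm :: "('f \<Rightarrow> nat) \<Rightarrow> ('x \<Rightarrow> nat) \<Rightarrow> ('f, 'v, 'x) trm \<Rightarrow> bool" where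
  "wf_trm ar arv (Var y) \<longleftrightarrow> True"
| "wf_trm ar arv (Fun f ts) \<longleftrightarrow> length ts = ar f \<and> (\<forall>t\<in>set ts. wf_trm ar arv t)"
| "wf_trm ar arv (FVar G ts) \<longleftrightarrow> length ts = arv G \<and> (\<forall>t\<in>set ts. wf_trm ar arv t)"

datatype ('f, 'v, 'x) sym = SFun 'f | SVar 'v | SFVar 'x

fun occ :: "('f, 'v, 'x) sym \<Rightarrow> ('f, 'v, 'x) trm \<Rightarrow> nat" where
  "occ c (Var y) = (if c = SVar y then 1 else 0)"
| "occ c (Fun f ts) = (if c = SFun f then 1 else 0) + (\<Sum>i<length ts. occ c (ts ! i))"
| "occ c (FVar G ts) = (if c = SFVar G then 1 else 0) + (\<Sum>i<length ts. occ c (ts ! i))"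

fun isubst :: "('v \<Rightarrow> ('f, 'v, 'x) trm) \<Rightarrow> ('f, 'v, 'x) trm \<Rightarrow> ('f, 'v, 'x) trm" where
  "isubst \<theta> (Var y) = \<theta> y"
| "isubst \<theta> (Fun f ts) = Fun f (map (isubst \<theta>) ts)"
| "isubst \<theta> (FVar G ts) = FVar G (map (isubst \<theta>) ts)"

definition inst :: "'v list \<Rightarrow> ('f, 'v, 'x) trm list \<Rightarrow> ('f, 'v, 'x) trm \<Rightarrow> ('f, 'v, 'x) trm" where
  "inst xs us s =
     isubst (\<lambda>y. case map_of (zip xs us) y of None \<Rightarrow> Var y | Some u \<Rightarrow> u) s"

text \<open>The \<open>\<beta>\<close>-normal form of the application of \<open>{F \<mapsto> \<lambda>xs. s}\<close> to a term.\<close>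

fun fsubst :: "'x \<Rightarrow> 'v list \<Rightarrow> ('f, 'v, 'x) trm \<Rightarrow> ('f, 'v, 'x) trm \<Rightarrow> ('f, 'v, 'x) trm" where
  "fsubst F xs s (Var y) = Var y"
| "fsubst F xs s (Fun f ts) = Fun f (map (fsubst F xs s) ts)"
| "fsubst F xs s (FVar G ts) =
     (if G = F then inst xs (map (fsubst F xs s) ts) s else FVar G (map (fsubst F xs s) ts))"

definition so_ground :: "('f \<Rightarrow> nat) \<Rightarrow> ('x \<Rightarrow> nat) \<Rightarrow> ('f, 'v, 'x) trm \<Rightarrow> bool" where
  "so_ground ar arv t \<longleftrightarrow>
     wf_trm ar arv t \<and> ivars t = {} \<and> fvars t \<noteq> {} \<and> (\<exists>n. \<forall>G\<in>fvars t. arv G = n)"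

definition sogu_problem ::
  "('f \<Rightarrow> nat) \<Rightarrow> ('x \<Rightarrow> nat) \<Rightarrow> (('f, 'v, 'x) trm \<times> ('f, 'v, 'x) trm) set \<Rightarrow> 'x \<Rightarrow> bool" where
  "sogu_problem ar arv U F \<longleftrightarrow>
     arv F > 0 \<and> finite U \<and>
     (\<forall>(u, v)\<in>U. so_ground ar arv u \<and> so_ground ar arv v \<and> fvars u = {F} \<and> fvars v = {F})"

definition sogu_unifier ::
  "('f \<Rightarrow> nat) \<Rightarrow> ('x \<Rightarrow> nat) \<Rightarrow> (('f, 'v, 'x) trm \<times> ('f, 'v, 'x) trm) set \<Rightarrow> 'x
    \<Rightarrow> 'v list \<Rightarrow> ('f, 'v, 'x) trm \<Rightarrow> bool" where
  "sogu_unifier ar arv U F xs s \<longleftrightarrow>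
     length xs = arv F \<and> distinct xs \<and> wf_trm ar arv s \<and> fvars s = {} \<and>
     (\<forall>(u, v)\<in>U. fsubst F xs s u = fsubst F xs s v)"

definition sogu_unifiable ::
  "('f \<Rightarrow> nat) \<Rightarrow> ('x \<Rightarrow> nat) \<Rightarrow> (('f, 'v, 'x) trm \<times> ('f, 'v, 'x) trm) set \<Rightarrow> 'x \<Rightarrow> bool" where
  "sogu_unifiable ar arv U F \<longleftrightarrow> (\<exists>xs s. sogu_unifier ar arv U F xs s)"

text \<open>The multiplier and the counter are meant for terms without individual variables and without
  function variables other than \<open>F\<close>; their value \<open>0\<close> elsewhere is a dummy. The parameter
  $h_{i+1}$ is \<open>hs ! i\<close>, and \<open>hs\<close> has length \<open>arv F\<close>.\<close>

fun mul :: "'x \<Rightarrow> nat list \<Rightarrow> ('f, 'v, 'x) trm \<Rightarrow> nat" where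
  "mul F hs (Var y) = 0"
| "mul F hs (Fun f ts) = (\<Sum>j<length ts. mul F hs (ts ! j))"
| "mul F hs (FVar G ts) =
     (if G = F then 1 + (\<Sum>i<length ts. hs ! i * mul F hs (ts ! i)) else 0)"

fun cnt :: "'x \<Rightarrow> nat list \<Rightarrow> 'f \<Rightarrow> ('f, 'v, 'x) trm \<Rightarrow> nat" where
  "cnt F hs g (Var y) = 0"
| "cnt F hs g (Fun f ts) = (if f = g then 1 else 0) + (\<Sum>j<length ts. cnt F hs g (ts ! j))"
| "cnt F hs g (FVar G ts) =
     (if G = F then (\<Sum>i<length ts. hs ! i * cnt F hs g (ts ! i)) else 0)"

definition mul_l :: "'x \<Rightarrow> nat list \<Rightarrow> (('f, 'v, 'x) trm \<times> ('f, 'v, 'x) trm) set \<Rightarrow> nat" where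
  "mul_l F hs U = (\<Sum>(u, v)\<in>U. mul F hs u)"

definition mul_r :: "'x \<Rightarrow> nat list \<Rightarrow> (('f, 'v, 'x) trm \<times> ('f, 'v, 'x) trm) set \<Rightarrow> nat" where
  "mul_r F hs U = (\<Sum>(u, v)\<in>U. mul F hs v)"

definition cnt_l :: "'x \<Rightarrow> nat list \<Rightarrow> 'f \<Rightarrow> (('f, 'v, 'x) trm \<times> ('f, 'v, 'x) trm) set \<Rightarrow> nat" where
  "cnt_l F hs g U = (\<Sum>(u, v)\<in>U. cnt F hs g u)"

definition cnt_r :: "'x \<Rightarrow> nat list \<Rightarrow> 'f \<Rightarrow> (('f, 'v, 'x) trm \<times> ('f, 'v, 'x) trm) set \<Rightarrow> nat" where
  "cnt_r F hs g U = (\<Sum>(u, v)\<in>U. cnt F hs g v)"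

end

theory Submission
  imports Defs
begin

text \<open>Applying \<open>{F \<mapsto> \<lambda>xs. s}\<close> to \<open>F(t\<^sub>1, \<dots>, t\<^sub>n)\<close> creates one copy of \<open>s\<close>
  and \<open>h\<^sub>i\<close> copies of the instance of \<open>t\<^sub>i\<close>. The number of occurrences of \<open>g\<close> in the
  instance of a term \<open>t\<close> is therefore \<open>occ(g, s) \<cdot> mul(t) + cnt(t)\<close>. The two sides of a
  unified equation have the same count; summing over all equations gives the claim.\<close>

text \<open>Collects the induction hypotheses for the arguments of a symbol: \<open>I\<close> ranges
  over argument positions, \<open>A\<close> over variables.\<close>

lemma sum_add_sum_mult:
  fixes a :: "'a \<Rightarrow> 'c::comm_semiring_0"
  shows "(\<Sum>i\<in>I. a i + (\<Sum>y\<in>A. b y i * c y))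
    = (\<Sum>i\<in>I. a i) + (\<Sum>y\<in>A. (\<Sum>i\<in>I. b y i) * c y)"
  by (simp add: sum.distrib sum_distrib_right sum.swap[of _ A])

text \<open>Each occurrence of \<open>y\<close> is replaced by a copy of \<open>\<theta> y\<close>.
  Summing over a fixed \<open>A\<close> containing \<open>ivars t\<close> lets all subterms share
  one index set.\<close>

lemma occ_SFun_isubst:
  assumes "finite A" and "ivars t \<subseteq> A"
  shows "occ (SFun g) (isubst \<theta> t)
    = occ (SFun g) t + (\<Sum>y\<in>A. occ (SVar y) t * occ (SFun g) (\<theta> y))"
  using assms(2)
proof (induction t)
  case (Var z)
  \<comment> \<open>Only \<open>y = z\<close> contributes, and \<open>z\<close> lies in the finite
    set \<open>A\<close>.\<close>
  have "(\<Sum>y\<in>A. occ (SVar y) (Var z) * occ (SFun g) (\<theta> y))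
      = (\<Sum>y\<in>A. if y = z then occ (SFun g) (\<theta> y) else 0)"
    by (rule sum.cong) auto
  then show ?case
    using Var \<open>finite A\<close> by simp
next
  case (Fun f ts)
  have "occ (SFun g) (isubst \<theta> (ts ! i))
      = occ (SFun g) (ts ! i) + (\<Sum>y\<in>A. occ (SVar y) (ts ! i) * occ (SFun g) (\<theta> y))"
    if "i < length ts" for i
    using that Fun.prems by (intro Fun.IH) (auto dest: nth_mem)
  then show ?case
    by (simp add: sum_add_sum_mult)
next
  case (FVar G ts)
  have "occ (SFun g) (isubst \<theta> (ts ! i))
      = occ (SFun g) (ts ! i) + (\<Sum>y\<in>A. occ (SVar y) (ts ! i) * occ (SFun g) (\<theta> y))"
    if "i < length ts" for i
    using that FVar.prems by (intro FVar.IH) (auto dest: nth_mem)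
  then show ?case
    by (simp add: sum_add_sum_mult)
qed

text \<open>Distinctness makes positions in \<open>xs\<close> correspond bijectively to variables,
  so the sum can be reindexed.\<close>

lemma occ_SFun_inst:
  assumes "distinct xs" and "length us = length xs" and "ivars s \<subseteq> set xs"
  shows "occ (SFun g) (inst xs us s)
    = occ (SFun g) s + (\<Sum>i<length xs. occ (SVar (xs ! i)) s * occ (SFun g) (us ! i))"
proof -
  define \<theta> where "\<theta> = (\<lambda>y. case map_of (zip xs us) y of None \<Rightarrow> Var y | Some u \<Rightarrow> u)"
  have \<theta>: "\<theta> (xs ! i) = us ! i" if "i < length xs" for i
    using assms that by (simp add: \<theta>_def map_of_zip_nth)
  have "(\<Sum>y\<in>set xs. occ (SVar y) s * occ (SFun g) (\<theta> y))
      = (\<Sum>i<length xs. occ (SVar (xs ! i)) s * occ (SFun g) (\<theta> (xs ! i)))"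
    using assms(1) by (intro sum.reindex_bij_betw[symmetric] bij_betw_nth) auto
  then show ?thesis
    using occ_SFun_isubst[OF finite_set assms(3), of g \<theta>]
    by (simp add: inst_def \<theta>_def[symmetric] \<theta>)
qed

text \<open>The inclusion \<open>fvars t \<subseteq> {F}\<close>, unlike equality, passes to
  subterms, which may be free of \<open>F\<close>.\<close>

lemma occ_SFun_fsubst:
  assumes xs: "distinct xs" "length xs = arv F" "ivars s \<subseteq> set xs"
    and hs: "\<And>i. i < arv F \<Longrightarrow> occ (SVar (xs ! i)) s = hs ! i"
    and t: "wf_trm ar arv t" "ivars t = {}" "fvars t \<subseteq> {F}"
  shows "occ (SFun g) (fsubst F xs s t) = occ (SFun g) s * mul F hs t + cnt F hs g t"
  using t
proof (induction t)
  case (Var y)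
  then show ?case by simp
next
  case (Fun f ts)
  have "occ (SFun g) (fsubst F xs s (ts ! i))
      = occ (SFun g) s * mul F hs (ts ! i) + cnt F hs g (ts ! i)" if "i < length ts" for i
    using that Fun.prems nth_mem[OF that] by (intro Fun.IH) fastforce+
  then show ?case
    by (simp add: sum.distrib sum_distrib_left)
next
  case (FVar G ts)
  \<comment> \<open>By well-formedness \<open>ts\<close> is as long as \<open>xs\<close>, so
    \<open>zip\<close> truncates nothing in \<open>inst\<close>.\<close>
  have G: "G = F" and len: "length ts = arv F"
    using FVar.prems by auto
  have "occ (SFun g) (fsubst F xs s (ts ! i))
      = occ (SFun g) s * mul F hs (ts ! i) + cnt F hs g (ts ! i)" if "i < length ts" for i
    using that FVar.prems nth_mem[OF that] by (intro FVar.IH) fastforce+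
  then show ?case
    using xs hs
    by (simp add: G len occ_SFun_inst sum.distrib sum_distrib_left algebra_simps)
qed

theorem lemma3p8:
  fixes ar :: "'f \<Rightarrow> nat" and arv :: "'x \<Rightarrow> nat"
    and U :: "(('f, 'v, 'x) trm \<times> ('f, 'v, 'x) trm) set"
    and F :: 'x and n :: nat and hs :: "nat list" and xs :: "'v list"
    and s :: "('f, 'v, 'x) trm"
  assumes "sogu_problem ar arv U F" and "sogu_unifiable ar arv U F"
    and "arv F = n" and "length hs = n"
    and "sogu_unifier ar arv U F xs s"
    and "ivars s \<subseteq> set xs"
    and "\<forall>i<n. occ (SVar (xs ! i)) s = hs ! i"
  shows "\<forall>g. int (occ (SFun g) s) * (int (mul_l F hs U) - int (mul_r F hs U))
               = int (cnt_r F hs g U) - int (cnt_l F hs g U)"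
proof
  fix g
  let ?o = "\<lambda>t. occ (SFun g) s * mul F hs t + cnt F hs g t"
  have "?o u = ?o v" if "(u, v) \<in> U" for u v
  proof -
    have occ: "occ (SFun g) (fsubst F xs s t) = ?o t"
      if "so_ground ar arv t" "fvars t = {F}" for t
      using that assms(3,5-7)
      by (intro occ_SFun_fsubst[where ar = ar and arv = arv]) (auto simp: so_ground_def sogu_unifier_def)
    have "so_ground ar arv u" "so_ground ar arv v" "fvars u = {F}" "fvars v = {F}"
      using assms(1) that by (auto simp: sogu_problem_def)
    moreover have "fsubst F xs s u = fsubst F xs s v"
      using assms(5) that by (auto simp: sogu_unifier_def)
    ultimately show ?thesis
      using occ by metis
  qed
  then have "(\<Sum>(u, v)\<in>U. ?o u) = (\<Sum>(u, v)\<in>U. ?o v)"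
    by (intro sum.cong) auto
  then have "occ (SFun g) s * mul_l F hs U + cnt_l F hs g U
      = occ (SFun g) s * mul_r F hs U + cnt_r F hs g U"
    by (simp add: mul_l_def mul_r_def cnt_l_def cnt_r_def case_prod_unfold
        sum.distrib sum_distrib_left)
  \<comment> \<open>The balance is kept additive over the naturals; the differences, possibly
    negative, are formed only after the cast.\<close>
  then have "int (occ (SFun g) s * mul_l F hs U + cnt_l F hs g U)
      = int (occ (SFun g) s * mul_r F hs U + cnt_r F hs g U)"
    by (rule arg_cong)
  then show "int (occ (SFun g) s) * (int (mul_l F hs U) - int (mul_r F hs U))
      = int (cnt_r F hs g U) - int (cnt_l F hs g U)"
    by (simp add: algebra_simps)
qed

end
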